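(* Let $P=\mathcal{Z}_4$ and $x\in P$. Let $\mathcal{O}$ be a promotion orbit of $\mathrm{Inc}^q(P)$. Then $\mathcal{O}$ exhibits orbitmesy with respect to the antipodal sum statistic $\mathcal{A}_x$ if and only if $\mathcal{O}$ avoids $1324$ or is balanced.
   Context: $\mathcal{Z}_4$ is the zig-zag (fence) poset $x_1\lessdot x_2 \gtrdot x_3\lessdot x_4$; it is self-dual with order-reversing involution $\kappa$ exchanging $x_1\leftrightarrow x_4$ and $x_2\leftrightarrow x_3$. An increasing labeling of a finite poset $P$ is $f:P\to\mathbb{N}$ with $f(x)<f(y)$ whenever $x<y$; $\mathrm{Inc}^q(P)$ is the set of increasing labelings with values in $[q]=\{1,\dots,q\}$. Promotion $\mathrm{Pro}$ on $\mathrm{Inc}^q(P)$: replace every label $1$ by an empty box; for $i=2,\dots,q$ in turn, perform the jeu de taquin slide $\sigma_i$ (a box at $x$ becomes $i$ if some $y\gtrdot x$ is labeled $i$, and an element labeled $i$ that covers a box becomes a box); then replace all boxes by $q+1$ and subtract $1$ from every label. The antipodal sum statistic is $\mathcal{A}_x(f)=f(x)+f(\kappa(x))$. An orbit $\mathcal{O}$ is orbitmesic with respect to a statistic $\eta$ if the average of $\eta$ over $\mathcal{O}$ equals the average of $\eta$ over all of $\mathrm{Inc}^q(P)$. A labeling of $\mathcal{Z}_4$ contains the pattern $\pi$ if the word of labels read left to right ($f(x_1)f(x_2)f(x_3)f(x_4)$) has a subsequence in the same relative order as $\pi$; it avoids $\pi$ otherwise, and an orbit avoids $\pi$ if all its labelings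 do. A labeling in $\mathrm{Inc}^q(\mathcal{Z}_4)$ whose labels in weakly increasing order are $w\le x\le y\le z$ is balanced if $x-w=z-y$ or $w-z+q=y-x$, and imbalanced otherwise; an orbit is balanced if its elements are (balancedness is constant on promotion orbits). *)

theory Defs
  imports Complex_Main "HOL-Combinatorics.Orbits" "HOL-Library.Sublist"
begin

definition covered_by :: "'a::order \<Rightarrow> 'a \<Rightarrow> bool" (infix "\<lessdot>" 50) where
  "x \<lessdot> y \<longleftrightarrow> x < y \<and> \<not> (\<exists>z. x < z \<and> z < y)"

text \<open>A finite poset is a type of class finite and order.\<close>

definition increasing_labeling :: "('a::{finite,order} \<Rightarrow> nat) \<Rightarrow> bool" where
  "increasing_labeling f \<longleftrightarrow> (\<forall>x y. x < y \<longrightarrow> f x < f y)"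

definition Inc :: "nat \<Rightarrow> ('a::{finite,order} \<Rightarrow> nat) set" where
  "Inc q = {f. increasing_labeling f \<and> range f \<subseteq> {1..q}}"

text \<open>During promotion labels live in \<^typ>\<open>nat option\<close>; \<^term>\<open>None\<close> is the empty box.\<close>

definition slide :: "nat \<Rightarrow> ('a::{finite,order} \<Rightarrow> nat option) \<Rightarrow> 'a \<Rightarrow> nat option" where
  "slide i g x =
     (if g x = None \<and> (\<exists>y. x \<lessdot> y \<and> g y = Some i) then Some i
      else if g x = Some i \<and> (\<exists>y. y \<lessdot> x \<and> g y = None) then None
      else g x)"

definition promotion :: "nat \<Rightarrow> ('a::{finite,order} \<Rightarrow> nat) \<Rightarrow> 'a \<Rightarrow> nat" where
  "promotion q f =
     (let g = fold slide [2..<Suc q] (\<lambda>x. if f x = 1 then None else Some (f x))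
      in (\<lambda>x. (case g x of None \<Rightarrow> q + 1 | Some k \<Rightarrow> k) - 1))"

text \<open>\<^const>\<open>orbit\<close> collects the iterates with positive exponent; since promotion permutes the
  finite set \<^term>\<open>Inc q\<close>, these include the starting labeling.\<close>

definition promotion_orbits :: "nat \<Rightarrow> ('a::{finite,order} \<Rightarrow> nat) set set" where
  "promotion_orbits q = orbit (promotion q) ` Inc q"

definition antipodal_sum :: "('a \<Rightarrow> 'a) \<Rightarrow> 'a \<Rightarrow> ('a \<Rightarrow> nat) \<Rightarrow> nat" where
  "antipodal_sum \<kappa> x f = f x + f (\<kappa> x)"

definition average :: "('b \<Rightarrow> real) \<Rightarrow> 'b set \<Rightarrow> real" where
  "average \<eta> A = (\<Sum>f\<in>A. \<eta> f) / real (card A)"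

definition orbitmesic ::
  "nat \<Rightarrow> (('a::{finite,order} \<Rightarrow> nat) \<Rightarrow> real) \<Rightarrow> ('a \<Rightarrow> nat) set \<Rightarrow> bool" where
  "orbitmesic q \<eta> \<O> \<longleftrightarrow> average \<eta> \<O> = average \<eta> (Inc q)"

definition same_relative_order :: "nat list \<Rightarrow> nat list \<Rightarrow> bool" where
  "same_relative_order u v \<longleftrightarrow> length u = length v \<and>
     (\<forall>i < length u. \<forall>j < length u. u ! i < u ! j \<longleftrightarrow> v ! i < v ! j)"

definition contains_pattern :: "nat list \<Rightarrow> nat list \<Rightarrow> bool" where
  "contains_pattern w \<pi> \<longleftrightarrow> (\<exists>v. subseq v w \<and> same_relative_order v \<pi>)"

datatype z4 = X1 | X2 | X3 | X4

lemma UNIV_z4: "(UNIV :: z4 set) = {X1, X2, X3, X4}"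
  using z4.exhaust by auto

instance z4 :: finite
  by standard (simp add: UNIV_z4)

instantiation z4 :: order
begin

definition less_z4 :: "z4 \<Rightarrow> z4 \<Rightarrow> bool" where
  "x < y \<longleftrightarrow> (x, y) \<in> {(X1, X2), (X3, X2), (X3, X4)}"

definition less_eq_z4 :: "z4 \<Rightarrow> z4 \<Rightarrow> bool" where
  "x \<le> y \<longleftrightarrow> x = y \<or> x < (y :: z4)"

instance
  by standard (auto simp: less_z4_def less_eq_z4_def)

end

fun kappa :: "z4 \<Rightarrow> z4" where
  "kappa X1 = X4"
| "kappa X2 = X3"
| "kappa X3 = X2"
| "kappa X4 = X1"

lemma covered_by_z4:
  "x \<lessdot> y \<longleftrightarrow> (x, y) \<in> {(X1, X2), (X3, X2), (X3, X4)}"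
  by (auto simp: covered_by_def less_z4_def)

lemma kappa_involution: "kappa (kappa x) = x"
  by (cases x) auto

lemma kappa_order_reversing: "kappa x \<le> kappa y \<longleftrightarrow> y \<le> x"
  by (cases x; cases y) (auto simp: less_eq_z4_def less_z4_def)

definition word :: "(z4 \<Rightarrow> nat) \<Rightarrow> nat list" where
  "word f = [f X1, f X2, f X3, f X4]"

definition orbit_avoids :: "(z4 \<Rightarrow> nat) set \<Rightarrow> nat list \<Rightarrow> bool" where
  "orbit_avoids \<O> \<pi> \<longleftrightarrow> (\<forall>f\<in>\<O>. \<not> contains_pattern (word f) \<pi>)"

text \<open>The labels are read as integers so that the differences are not truncated.\<close>

definition balanced :: "nat \<Rightarrow> (z4 \<Rightarrow> nat) \<Rightarrow> bool" where
  "balanced q f \<longleftrightarrow>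
     (\<exists>w x y z :: int. map int (sort (word f)) = [w, x, y, z] \<and>
        (x - w = z - y \<or> w - z + int q = y - x))"

definition orbit_balanced :: "nat \<Rightarrow> (z4 \<Rightarrow> nat) set \<Rightarrow> bool" where
  "orbit_balanced q \<O> \<longleftrightarrow> (\<forall>f\<in>\<O>. balanced q f)"

end

theory Submission
  imports Defs
begin

text \<open>
  Both antipodal sums are coboundaries up to a constant.  For each of them there is an explicit
  function \<open>h\<close>, polynomial in the labels on every class of words of the same relative order, and an
  orbit invariant \<open>k\<close> with \<open>2q (A f - (q + 1)) = h (Pro f) - h f \<plusminus> 2k\<close>.  Summing over an orbit
  telescopes, so the average is \<open>q + 1 \<plusminus> k/q\<close>, while the average over all labelings is \<open>q + 1\<close> by
  duality.  The invariant \<open>k\<close> vanishes except on orbits whose words have distinct letters and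
  alternate between the relative orders 1324 and 2413; there it is, up to sign, the product of the
  two differences whose vanishing defines balancedness.
\<close>

section \<open>Sums and averages over orbits of an injection\<close>

lemma orbit_subset:
  assumes "p ` S \<subseteq> S" "f \<in> S"
  shows "orbit p f \<subseteq> S"
proof
  fix g assume "g \<in> orbit p f"
  then show "g \<in> S" by induction (use assms in auto)
qed

text \<open>The orbit is finite and \<open>p\<close> maps it injectively into itself, so
  \<open>p\<close> permutes it.\<close>

lemma sum_orbit_comp:
  fixes h :: "'b \<Rightarrow> 'c::comm_monoid_add"
  assumes "finite S" "inj_on p S" "p ` S \<subseteq> S" "f \<in> S"
  shows "(\<Sum>g\<in>orbit p f. h (p g)) = (\<Sum>g\<in>orbit p f. h g)"
proof -
  have inj: "inj_on p (orbit p f)" and fin: "finite (orbit p f)"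
    using assms(1,2) orbit_subset[OF assms(3,4)] by (auto intro: inj_on_subset finite_subset)
  have "p ` orbit p f \<subseteq> orbit p f" by (auto intro: orbit.step)
  then have "p ` orbit p f = orbit p f" using fin inj by (simp add: endo_inj_surj)
  then show ?thesis using sum.reindex[OF inj, of h] by simp
qed

text \<open>The differences \<open>h (p g) - h g\<close> cancel over the orbit, so each element
  contributes only \<open>k\<close> on average. Everything stays in the integers until the final
  division by \<open>m\<close>.\<close>

lemma average_orbit_coboundary:
  fixes h :: "'b \<Rightarrow> int" and \<eta> :: "'b \<Rightarrow> int"
  assumes S: "finite S" "inj_on p S" "p ` S \<subseteq> S" "f \<in> S"
    and eq: "\<And>g. g \<in> orbit p f \<Longrightarrow> m * (\<eta> g - c) = h (p g) - h g + k"
    and "m \<noteq> 0"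
  shows "average (\<lambda>g. real_of_int (\<eta> g)) (orbit p f) = c + k / m"
proof -
  let ?O = "orbit p f"
  have "finite ?O" using orbit_subset[OF S(3,4)] S(1) by (rule finite_subset)
  moreover have "?O \<noteq> {}" using orbit.base[of p f] by auto
  ultimately have card: "card ?O \<noteq> 0" by auto
  have "m * (\<Sum>g\<in>?O. \<eta> g - c) = (\<Sum>g\<in>?O. h (p g) - h g + k)"
    unfolding sum_distrib_left using eq by (auto intro: sum.cong)
  also have "\<dots> = card ?O * k"
    using sum_orbit_comp[OF S, of h] by (simp add: sum.distrib sum_subtractf)
  finally have "m * (\<Sum>g\<in>?O. \<eta> g) = card ?O * (m * c + k)"
    by (simp add: sum_subtractf algebra_simps)
  then have "real_of_int m * (\<Sum>g\<in>?O. real_of_int (\<eta> g)) = card ?O * (m * c + k)"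
    by (metis (mono_tags, lifting) of_int_add of_int_mult of_int_of_nat_eq of_int_sum)
  then show ?thesis
    using card \<open>m \<noteq> 0\<close> by (simp add: average_def field_simps)
qed

section \<open>The global average, by duality\<close>

lemma finite_Inc: "finite (Inc q :: ('a::{finite,order} \<Rightarrow> nat) set)"
proof -
  have "Inc q \<subseteq> PiE (UNIV :: 'a set) (\<lambda>_. {1..q})" by (auto simp: Inc_def)
  then show ?thesis by (rule finite_subset) (simp add: finite_PiE)
qed

text \<open>Composing with \<kappa> and complementing the labels in \<open>q + 1\<close> is an
  involution \<rho> of \<open>Inc q\<close> that turns an antipodal sum \<open>A\<close> into
  \<open>2 * (q + 1) - A\<close>.\<close>

lemma average_antipodal_sum_Inc:
  fixes \<kappa> :: "'a::{finite,order} \<Rightarrow> 'a"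
  assumes inv: "\<And>x. \<kappa> (\<kappa> x) = x" and rev: "\<And>x y. \<kappa> x \<le> \<kappa> y \<longleftrightarrow> y \<le> x"
    and ne: "Inc q \<noteq> ({} :: ('a \<Rightarrow> nat) set)"
  shows "average (\<lambda>f. real (antipodal_sum \<kappa> x f)) (Inc q) = q + 1"
proof -
  define \<rho> where "\<rho> f = (\<lambda>x. q + 1 - f (\<kappa> x))" for f :: "'a \<Rightarrow> nat"
  have lt: "\<kappa> x < \<kappa> y \<longleftrightarrow> y < x" for x y using rev by (simp add: less_le_not_le)
  have le: "1 \<le> f x \<and> f x \<le> q" if "f \<in> Inc q" for f :: "'a \<Rightarrow> nat" and x
    using that by (auto simp: Inc_def image_subset_iff)
  have \<rho>_Inc: "\<rho> f \<in> Inc q" if f: "f \<in> Inc q" for f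
  proof -
    have "\<rho> f x < \<rho> f y" if "x < y" for x y
    proof -
      have "f (\<kappa> y) < f (\<kappa> x)" using f that lt by (simp add: Inc_def increasing_labeling_def)
      then show ?thesis using le[OF f, of "\<kappa> x"] by (simp add: \<rho>_def)
    qed
    moreover have "1 \<le> \<rho> f x \<and> \<rho> f x \<le> q" for x
      using le[OF f, of "\<kappa> x"] by (auto simp: \<rho>_def)
    ultimately show ?thesis by (auto simp: Inc_def increasing_labeling_def)
  qed
  have \<rho>\<rho>: "\<rho> (\<rho> f) = f" if "f \<in> Inc q" for f
    using le[OF that] by (simp add: \<rho>_def inv fun_eq_iff le_SucI)
  let ?A = "\<lambda>f. real (antipodal_sum \<kappa> x f)"
  have "(\<Sum>f\<in>Inc q. ?A f) = (\<Sum>f\<in>Inc q. ?A (\<rho> f))"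
    by (rule sum.reindex_bij_witness[of _ \<rho> \<rho>]) (use \<rho>_Inc \<rho>\<rho> in auto)
  also have "\<dots> = (\<Sum>f\<in>Inc q. 2 * (real q + 1) - ?A f)"
  proof (rule sum.cong)
    fix f :: "'a \<Rightarrow> nat" assume "f \<in> Inc q"
    from le[OF this, of x] le[OF this, of "\<kappa> x"]
    show "?A (\<rho> f) = 2 * (real q + 1) - ?A f"
      by (simp add: antipodal_sum_def \<rho>_def inv of_nat_diff)
  qed simp
  finally have "(\<Sum>f\<in>Inc q. ?A f) = card (Inc q :: ('a \<Rightarrow> nat) set) * (real q + 1)"
    by (simp add: sum_subtractf algebra_simps)
  then show ?thesis using ne finite_Inc[of q, where 'a='a] by (simp add: average_def field_simps)
qed

section \<open>Promotion on the fence in closed form\<close>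

lemma ex_z4: "(\<exists>x::z4. P x) \<longleftrightarrow> P X1 \<or> P X2 \<or> P X3 \<or> P X4"
  by (metis z4.exhaust)

lemma all_z4: "(\<forall>x::z4. P x) \<longleftrightarrow> P X1 \<and> P X2 \<and> P X3 \<and> P X4"
  by (metis z4.exhaust)

lemma Inc_z4:
  "f \<in> Inc q \<longleftrightarrow> f X1 < f X2 \<and> f X3 < f X2 \<and> f X3 < f X4 \<and>
     1 \<le> f X1 \<and> 1 \<le> f X3 \<and> f X2 \<le> q \<and> f X4 \<le> q"
  by (auto simp: Inc_def increasing_labeling_def all_z4 less_z4_def image_subset_iff)

lemma slide_z4:
  fixes g :: "z4 \<Rightarrow> nat option"
  shows "slide i g X1 = (if g X1 = None \<and> g X2 = Some i then Some i else g X1)"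
    and "slide i g X2 = (if g X2 = Some i \<and> (g X1 = None \<or> g X3 = None) then None else g X2)"
    and "slide i g X3 = (if g X3 = None \<and> (g X2 = Some i \<or> g X4 = Some i) then Some i else g X3)"
    and "slide i g X4 = (if g X4 = Some i \<and> g X3 = None then None else g X4)"
  by (auto simp: slide_def ex_z4 covered_by_z4)

text \<open>Loop invariant of the slides. A box at \<open>X1\<close> waits for the label of
  \<open>X2\<close>, a box at \<open>X3\<close> for the smaller of its two upper labels. Hence
  \<open>X2\<close> is emptied through \<open>X3\<close> only if \<open>f X2 \<le> f X4\<close>;
  otherwise \<open>X4\<close> has already filled that box.\<close>

lemma fold_slide_z4:
  fixes f :: "z4 \<Rightarrow> nat"
  assumes f: "f \<in> Inc q" and k: "1 \<le> k"
  defines "g \<equiv> fold slide [2..<Suc k] (\<lambda>x. if f x = 1 then None else Some (f x))"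
  shows "g X1 = (if f X1 = 1 then if f X2 \<le> k then Some (f X2) else None else Some (f X1))"
    and "g X2 = (if (f X1 = 1 \<or> f X3 = 1 \<and> f X2 \<le> f X4) \<and> f X2 \<le> k then None else Some (f X2))"
    and "g X3 = (if f X3 = 1 then if min (f X2) (f X4) \<le> k then Some (min (f X2) (f X4)) else None
                 else Some (f X3))"
    and "g X4 = (if f X3 = 1 \<and> f X4 \<le> f X2 \<and> f X4 \<le> k then None else Some (f X4))"
  unfolding g_def atomize_conj using k
proof (induction k rule: dec_induct)
  \<comment> \<open>No slide has run yet: the boxes are the labels 1, and upper labels exceed
    1.\<close>
  case base
  then show ?case using f by (auto simp: Inc_z4)
next
  case (step n)
  define h where "h = fold slide [2..<Suc n] (\<lambda>x. if f x = 1 then None else Some (f x))"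
  have eq: "fold slide [2..<Suc (Suc n)] (\<lambda>x. if f x = 1 then None else Some (f x)) = slide (Suc n) h"
    using step.hyps by (simp add: h_def)
  note IH = step.IH[folded h_def]
  note less = f[unfolded Inc_z4]
  have "slide (Suc n) h X1 =
      (if f X1 = 1 then if f X2 \<le> Suc n then Some (f X2) else None else Some (f X1))"
    using less by (simp only: slide_z4 IH) (auto simp: le_Suc_eq)
  moreover have "slide (Suc n) h X2 =
      (if (f X1 = 1 \<or> f X3 = 1 \<and> f X2 \<le> f X4) \<and> f X2 \<le> Suc n then None else Some (f X2))"
    using less by (simp only: slide_z4 IH) (auto simp: le_Suc_eq)
  moreover have "slide (Suc n) h X3 =
      (if f X3 = 1 then if min (f X2) (f X4) \<le> Suc n then Some (min (f X2) (f X4)) else None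
       else Some (f X3))"
    using less by (simp only: slide_z4 IH) (auto simp: le_Suc_eq min_def)
  moreover have "slide (Suc n) h X4 =
      (if f X3 = 1 \<and> f X4 \<le> f X2 \<and> f X4 \<le> Suc n then None else Some (f X4))"
    using less by (simp only: slide_z4 IH) (auto simp: le_Suc_eq)
  ultimately show ?case unfolding eq by blast
qed

lemma promotion_z4:
  fixes f :: "z4 \<Rightarrow> nat"
  assumes "f \<in> Inc q"
  shows "promotion q f X1 = (if f X1 = 1 then f X2 - 1 else f X1 - 1)"
    and "promotion q f X2 = (if f X1 = 1 \<or> f X3 = 1 \<and> f X2 \<le> f X4 then q else f X2 - 1)"
    and "promotion q f X3 = (if f X3 = 1 then min (f X2) (f X4) - 1 else f X3 - 1)"
    and "promotion q f X4 = (if f X3 = 1 \<and> f X4 \<le> f X2 then q else f X4 - 1)"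
proof -
  have "1 \<le> q" using assms by (auto simp: Inc_z4)
  note g = fold_slide_z4[OF assms this]
  note less = assms[unfolded Inc_z4]
  show "promotion q f X1 = (if f X1 = 1 then f X2 - 1 else f X1 - 1)"
    unfolding promotion_def Let_def g using less by (cases "f X1 = 1") simp_all
  show "promotion q f X2 = (if f X1 = 1 \<or> f X3 = 1 \<and> f X2 \<le> f X4 then q else f X2 - 1)"
    unfolding promotion_def Let_def g using less by (cases "f X1 = 1"; cases "f X3 = 1") simp_all
  show "promotion q f X3 = (if f X3 = 1 then min (f X2) (f X4) - 1 else f X3 - 1)"
    unfolding promotion_def Let_def g using less by (cases "f X3 = 1") (simp_all add: min_def)
  show "promotion q f X4 = (if f X3 = 1 \<and> f X4 \<le> f X2 then q else f X4 - 1)"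
    unfolding promotion_def Let_def g using less by (cases "f X3 = 1") simp_all
qed

text \<open>The cases are named by the minimal elements that carry 1 (\<open>left\<close> for
  \<open>X1\<close>, \<open>right\<close> for \<open>X3\<close>); the suffix compares
  \<open>b\<close> with \<open>d\<close>, which decides who fills a box at \<open>X3\<close>.
  Integer labels keep the later identities free of truncated subtraction.\<close>

lemma promotion_z4_cases [consumes 1]:
  fixes f :: "z4 \<Rightarrow> nat"
  assumes f: "f \<in> Inc q"
  defines "a \<equiv> int (f X1)" and "b \<equiv> int (f X2)" and "c \<equiv> int (f X3)" and "d \<equiv> int (f X4)"
    and "a' \<equiv> int (promotion q f X1)" and "b' \<equiv> int (promotion q f X2)"
    and "c' \<equiv> int (promotion q f X3)" and "d' \<equiv> int (promotion q f X4)"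
  obtains (none) "1 < a" "1 < c" "a' = a - 1" "b' = b - 1" "c' = c - 1" "d' = d - 1"
  | (left) "a = 1" "1 < c" "a' = b - 1" "b' = q" "c' = c - 1" "d' = d - 1"
  | (right_lt) "1 < a" "c = 1" "b < d" "a' = a - 1" "b' = q" "c' = b - 1" "d' = d - 1"
  | (right_eq) "1 < a" "c = 1" "b = d" "a' = a - 1" "b' = q" "c' = b - 1" "d' = q"
  | (right_gt) "1 < a" "c = 1" "d < b" "a' = a - 1" "b' = b - 1" "c' = d - 1" "d' = q"
  | (both_lt) "a = 1" "c = 1" "b < d" "a' = b - 1" "b' = q" "c' = b - 1" "d' = d - 1"
  | (both_eq) "a = 1" "c = 1" "b = d" "a' = b - 1" "b' = q" "c' = b - 1" "d' = q"
  | (both_gt) "a = 1" "c = 1" "d < b" "a' = b - 1" "b' = q" "c' = d - 1" "d' = q"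
proof -
  note less = f[unfolded Inc_z4]
  consider "f X1 = 1" "f X3 = 1" | "f X1 = 1" "1 < f X3" | "1 < f X1" "f X3 = 1"
    | "1 < f X1" "1 < f X3"
    using less by linarith
  then show thesis
  proof cases
    case 1
    then show thesis using less both_lt both_eq both_gt
      by (cases "f X2" "f X4" rule: linorder_cases)
        (simp_all add: promotion_z4[OF f] a_def b_def c_def d_def a'_def b'_def c'_def d'_def of_nat_diff)
  next
    case 2
    then show thesis using less left
      by (simp add: promotion_z4[OF f] a_def b_def c_def d_def a'_def b'_def c'_def d'_def of_nat_diff)
  next
    case 3
    then show thesis using less right_lt right_eq right_gt
      by (cases "f X2" "f X4" rule: linorder_cases)
        (simp_all add: promotion_z4[OF f] a_def b_def c_def d_def a'_def b'_def c'_def d'_def of_nat_diff)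
  next
    case 4
    then show thesis using less none
      by (simp add: promotion_z4[OF f] a_def b_def c_def d_def a'_def b'_def c'_def d'_def of_nat_diff)
  qed
qed

lemma Inc_z4_int:
  "f \<in> Inc q \<longleftrightarrow> int (f X1) < f X2 \<and> int (f X3) < f X2 \<and> int (f X3) < f X4 \<and>
     1 \<le> int (f X1) \<and> 1 \<le> int (f X3) \<and> int (f X2) \<le> q \<and> int (f X4) \<le> q"
  unfolding Inc_z4 by linarith

section \<open>Promotion permutes the increasing labelings\<close>

lemma promotion_in_Inc:
  fixes f :: "z4 \<Rightarrow> nat"
  assumes f: "f \<in> Inc q"
  shows "promotion q f \<in> Inc q"
  using f[unfolded Inc_z4_int] unfolding Inc_z4_int
  by (cases rule: promotion_z4_cases[OF f]) auto

text \<open>An upper element carries \<open>q\<close> exactly when a box ended there. For a box at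
  \<open>X2\<close>, comparing \<open>a\<close> with \<open>c\<close> reveals whether it came from
  \<open>X1\<close>, \<open>X3\<close> or both.\<close>

lemma promotion_z4_inverse:
  fixes f :: "z4 \<Rightarrow> nat"
  assumes f: "f \<in> Inc q"
  defines "a \<equiv> int (promotion q f X1)" and "b \<equiv> int (promotion q f X2)"
    and "c \<equiv> int (promotion q f X3)" and "d \<equiv> int (promotion q f X4)"
  shows "int (f X1) = (if b = q \<and> c \<le> a then 1 else a + 1)"
    and "int (f X2) = (if b = q then max a c + 1 else b + 1)"
    and "int (f X3) = (if d = q \<or> b = q \<and> a \<le> c then 1 else c + 1)"
    and "int (f X4) = (if d = q then c + 1 else d + 1)"
  unfolding atomize_conj using f[unfolded Inc_z4_int] unfolding a_def b_def c_def d_def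
  by (cases rule: promotion_z4_cases[OF f]) auto

lemma inj_on_promotion: "inj_on (promotion q) (Inc q :: (z4 \<Rightarrow> nat) set)"
proof
  fix f g :: "z4 \<Rightarrow> nat"
  assume "f \<in> Inc q" "g \<in> Inc q" "promotion q f = promotion q g"
  then have "int (f X1) = int (g X1) \<and> int (f X2) = int (g X2) \<and>
      int (f X3) = int (g X3) \<and> int (f X4) = int (g X4)"
    by (simp only: promotion_z4_inverse)
  then show "f = g" by (simp add: fun_eq_iff all_z4)
qed

section \<open>The potentials and the invariant\<close>

text \<open>With \<open>u\<close> the difference of two labels this is invariant under rotation of the label circle
  \<open>\<int>/q\<close>; with \<open>u\<close> a label it changes by \<open>2u - (q + 1)\<close> when that label rotates.\<close>

definition arc :: "int \<Rightarrow> int \<Rightarrow> int" where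
  "arc q u = u * (q - u)"

definition alternating :: "(z4 \<Rightarrow> nat) \<Rightarrow> bool" where
  "alternating f \<longleftrightarrow> f X1 < f X3 \<and> f X3 < f X2 \<and> f X2 < f X4 \<or>
     f X3 < f X1 \<and> f X1 < f X4 \<and> f X4 < f X2"

text \<open>For sorted labels \<open>w < x < y < z\<close> the two factors are \<open>(z - y) - (x - w)\<close> and
  \<open>(w - z + q) - (y - x)\<close>.  An event of promotion rotates the four cyclic gaps, which changes the sign
  of the product, and swaps the two alternating shapes, which changes it back.\<close>

definition defect :: "int \<Rightarrow> int \<Rightarrow> int \<Rightarrow> int \<Rightarrow> int \<Rightarrow> int" where
  "defect q a b c d =
     (if a < c \<and> c < b \<and> b < d then (d - b - (c - a)) * (a - d + q - (b - c))
      else if c < a \<and> a < d \<and> d < b then - ((b - d - (a - c)) * (c - b + q - (d - a)))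
      else 0)"

text \<open>If all labels just rotated, sums of \<^const>\<open>arc\<close> of labels would be potentials for the antipodal
  sums.  When a box slides along an edge, the labels at its ends trade places; the next two functions
  account for this.  Their coefficients are the solution of a linear system, one equation for each
  transition between relative orders of the labels.\<close>

definition swap_term :: "int \<Rightarrow> int \<Rightarrow> int \<Rightarrow> int \<Rightarrow> int \<Rightarrow> int" where
  "swap_term q a b c d =
     (if a < c then
        if b < d then 0
        else if b = d then arc q (b - c) + 2 * arc q (c - a)
        else arc q (d - c) + arc q (c - a)
      else if a = c then
        if b < d then arc q (b - c) + 2 * arc q (d - b)
        else if b = d then 0
        else arc q (b - c) + 2 * arc q (d - a)
      else
        if b < d then arc q (b - a) + arc q (d - b)
        else if b = d then arc q (b - c) + 2 * arc q (d - a)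
        else if a < d then arc q (d - c)
        else if a = d then arc q (b - a) + arc q (a - c) + 2 * arc q (b - c)
        else arc q (b - a) + arc q (d - c) + arc q (b - c))"

definition tie_term :: "int \<Rightarrow> int \<Rightarrow> int \<Rightarrow> int \<Rightarrow> int \<Rightarrow> int" where
  "tie_term q a b c d =
     (if a = c \<and> b < d then arc q (d - b)
      else if a < c \<and> b = d then arc q (c - a)
      else if a = c \<and> d < b \<or> c < a \<and> b = d then arc q (d - a) + arc q (b - c)
      else if a = d then arc q (b - c)
      else 0)"

text \<open>In the sum of both potentials \<open>swap_term\<close> and \<open>defect\<close> cancel.
  What is left beside the arcs is \<open>tie_term\<close>, which vanishes for distinct labels:
  promotion rotates the set of labels, but can move multiplicities between coinciding ones.\<close>

definition outer_potential :: "nat \<Rightarrow> (z4 \<Rightarrow> nat) \<Rightarrow> int" where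
  "outer_potential q f =
     (let a = int (f X1); b = int (f X2); c = int (f X3); d = int (f X4)
      in q * (arc q a + arc q d - swap_term q a b c d - tie_term q a b c d)
           + defect q a b c d * (a + b))"

definition inner_potential :: "nat \<Rightarrow> (z4 \<Rightarrow> nat) \<Rightarrow> int" where
  "inner_potential q f =
     (let a = int (f X1); b = int (f X2); c = int (f X3); d = int (f X4)
      in q * (arc q b + arc q c + swap_term q a b c d) - defect q a b c d * (a + b))"

section \<open>Invariance and coboundary identities, event by event\<close>

lemma alternating_int:
  "alternating f \<longleftrightarrow> int (f X1) < f X3 \<and> int (f X3) < f X2 \<and> int (f X2) < f X4 \<or>
     int (f X3) < f X1 \<and> int (f X1) < f X4 \<and> int (f X4) < f X2"
  by (simp add: alternating_def)

text \<open>\<open>none\<close> keeps each shape, \<open>left\<close> takes 1324 to 2413 and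
  \<open>right_gt\<close> takes 2413 to 1324. The other events neither start nor end in an
  alternating shape.\<close>

lemma alternating_promotion:
  fixes f :: "z4 \<Rightarrow> nat"
  assumes f: "f \<in> Inc q"
  shows "alternating (promotion q f) \<longleftrightarrow> alternating f"
proof -
  define a b c d where abcd: "a = int (f X1)" "b = int (f X2)" "c = int (f X3)" "d = int (f X4)"
  have less: "a < b" "c < b" "c < d" "1 \<le> a" "1 \<le> c" "b \<le> q" "d \<le> q"
    using f[unfolded Inc_z4_int] by (auto simp: abcd)
  show ?thesis
    using f
  proof (cases rule: promotion_z4_cases)
    case none
    from this[folded abcd] less show ?thesis
      unfolding alternating_int abcd[symmetric] none[folded abcd]
      by auto
  next
    case left
    from this[folded abcd] less show ?thesis
      unfolding alternating_int abcd[symmetric] left[folded abcd]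
      by auto
  next
    case right_lt
    from this[folded abcd] less show ?thesis
      unfolding alternating_int abcd[symmetric] right_lt[folded abcd]
      by auto
  next
    case right_eq
    from this[folded abcd] less show ?thesis
      unfolding alternating_int abcd[symmetric] right_eq[folded abcd]
      by auto
  next
    case right_gt
    from this[folded abcd] less show ?thesis
      unfolding alternating_int abcd[symmetric] right_gt[folded abcd]
      by auto
  next
    case both_lt
    from this[folded abcd] less show ?thesis
      unfolding alternating_int abcd[symmetric] both_lt[folded abcd]
      by auto
  next
    case both_eq
    from this[folded abcd] less show ?thesis
      unfolding alternating_int abcd[symmetric] both_eq[folded abcd]
      by auto
  next
    case both_gt
    from this[folded abcd] less show ?thesis
      unfolding alternating_int abcd[symmetric] both_gt[folded abcd]
      by auto
  qed
qed

lemma defect_promotion: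
  fixes f :: "z4 \<Rightarrow> nat"
  assumes f: "f \<in> Inc q"
  defines "p \<equiv> promotion q f"
  shows "defect q (p X1) (p X2) (p X3) (p X4) = defect q (f X1) (f X2) (f X3) (f X4)"
proof -
  define a b c d where abcd: "a = int (f X1)" "b = int (f X2)" "c = int (f X3)" "d = int (f X4)"
  have less: "a < b" "c < b" "c < d" "1 \<le> a" "1 \<le> c" "b \<le> q" "d \<le> q"
    using f[unfolded Inc_z4_int] by (auto simp: abcd)
  show ?thesis
    using f
  proof (cases rule: promotion_z4_cases)
    case none
    from this[folded abcd] less show ?thesis
      unfolding p_def abcd[symmetric] none[folded abcd]
      by (simp add: defect_def; simp add: algebra_simps)
  next
    case left
    from this[folded abcd] less show ?thesis
      unfolding p_def abcd[symmetric] left[folded abcd]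
      \<comment> \<open>The event leaves the order of \<open>b\<close> and \<open>d\<close> open,
        but it becomes the order of the new labels of \<open>X1\<close> and
        \<open>X4\<close>.\<close>
      by (cases b d rule: linorder_cases; simp add: defect_def; simp add: algebra_simps)
  next
    case right_lt
    from this[folded abcd] less show ?thesis
      unfolding p_def abcd[symmetric] right_lt[folded abcd]
      by (simp add: defect_def; simp add: algebra_simps)
  next
    case right_eq
    from this[folded abcd] less show ?thesis
      unfolding p_def abcd[symmetric] right_eq[folded abcd]
      by (simp add: defect_def; simp add: algebra_simps)
  next
    case right_gt
    from this[folded abcd] less show ?thesis
      unfolding p_def abcd[symmetric] right_gt[folded abcd]
      \<comment> \<open>Likewise the order of \<open>a\<close> and \<open>d\<close> becomes that of
        the new labels of \<open>X1\<close> and \<open>X3\<close>.\<close>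
      by (cases a d rule: linorder_cases; simp add: defect_def; simp add: algebra_simps)
  next
    case both_lt
    from this[folded abcd] less show ?thesis
      unfolding p_def abcd[symmetric] both_lt[folded abcd]
      by (simp add: defect_def; simp add: algebra_simps)
  next
    case both_eq
    from this[folded abcd] less show ?thesis
      unfolding p_def abcd[symmetric] both_eq[folded abcd]
      by (simp add: defect_def; simp add: algebra_simps)
  next
    case both_gt
    from this[folded abcd] less show ?thesis
      unfolding p_def abcd[symmetric] both_gt[folded abcd]
      by (simp add: defect_def; simp add: algebra_simps)
  qed
qed

text \<open>The sum \<open>a + b\<close> drops by 2 in \<open>none\<close> and
  \<open>right_gt\<close> and changes by \<open>q - 2\<close> in \<open>left\<close>. So where
  \<open>defect\<close> is nonzero, its product with \<open>a + b\<close> cancels the constant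
  \<open>2 * defect\<close>, except for a surplus \<open>q * defect\<close> in \<open>left\<close>
  that the arc terms absorb.\<close>

lemma outer_potential_promotion:
  fixes f :: "z4 \<Rightarrow> nat"
  assumes f: "f \<in> Inc q"
  shows "2 * q * ((int (f X1) + int (f X4)) - (q + 1)) =
    outer_potential q (promotion q f) - outer_potential q f
      + 2 * defect q (f X1) (f X2) (f X3) (f X4)"
proof -
  define a b c d where abcd: "a = int (f X1)" "b = int (f X2)" "c = int (f X3)" "d = int (f X4)"
  have less: "a < b" "c < b" "c < d" "1 \<le> a" "1 \<le> c" "b \<le> q" "d \<le> q"
    using f[unfolded Inc_z4_int] by (auto simp: abcd)
  note defs = defect_def swap_term_def tie_term_def
  show ?thesis
    using f
  proof (cases rule: promotion_z4_cases)
    case none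
    from this[folded abcd] less show ?thesis
      unfolding outer_potential_def Let_def abcd[symmetric] none[folded abcd]
      \<comment> \<open>The first \<open>simp\<close> treats the comparisons with \<open>arc\<close>
        still folded; the second checks the polynomial identities.\<close>
      by (simp add: defs; simp add: arc_def algebra_simps)
  next
    case left
    from this[folded abcd] less show ?thesis
      unfolding outer_potential_def Let_def abcd[symmetric] left[folded abcd]
      by (cases b d rule: linorder_cases; simp add: defs; simp add: arc_def algebra_simps)
  next
    case right_lt
    from this[folded abcd] less show ?thesis
      unfolding outer_potential_def Let_def abcd[symmetric] right_lt[folded abcd]
      by (simp add: defs; simp add: arc_def algebra_simps)
  next
    case right_eq
    from this[folded abcd] less show ?thesis
      unfolding outer_potential_def Let_def abcd[symmetric] right_eq[folded abcd]
      by (simp add: defs; simp add: arc_def algebra_simps)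
  next
    case right_gt
    from this[folded abcd] less show ?thesis
      unfolding outer_potential_def Let_def abcd[symmetric] right_gt[folded abcd]
      by (cases a d rule: linorder_cases; simp add: defs; simp add: arc_def algebra_simps)
  next
    case both_lt
    from this[folded abcd] less show ?thesis
      unfolding outer_potential_def Let_def abcd[symmetric] both_lt[folded abcd]
      by (simp add: defs; simp add: arc_def algebra_simps)
  next
    case both_eq
    from this[folded abcd] less show ?thesis
      unfolding outer_potential_def Let_def abcd[symmetric] both_eq[folded abcd]
      by (simp add: defs; simp add: arc_def algebra_simps)
  next
    case both_gt
    from this[folded abcd] less show ?thesis
      unfolding outer_potential_def Let_def abcd[symmetric] both_gt[folded abcd]
      by (simp add: defs; simp add: arc_def algebra_simps)
  qed
qed

lemma inner_potential_promotion:
  fixes f :: "z4 \<Rightarrow> nat"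
  assumes f: "f \<in> Inc q"
  shows "2 * q * ((int (f X2) + int (f X3)) - (q + 1)) =
    inner_potential q (promotion q f) - inner_potential q f
      - 2 * defect q (f X1) (f X2) (f X3) (f X4)"
proof -
  define a b c d where abcd: "a = int (f X1)" "b = int (f X2)" "c = int (f X3)" "d = int (f X4)"
  have less: "a < b" "c < b" "c < d" "1 \<le> a" "1 \<le> c" "b \<le> q" "d \<le> q"
    using f[unfolded Inc_z4_int] by (auto simp: abcd)
  note defs = defect_def swap_term_def tie_term_def
  show ?thesis
    using f
  proof (cases rule: promotion_z4_cases)
    case none
    from this[folded abcd] less show ?thesis
      unfolding inner_potential_def Let_def abcd[symmetric] none[folded abcd]
      by (simp add: defs; simp add: arc_def algebra_simps)
  next
    case left
    from this[folded abcd] less show ?thesis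
      unfolding inner_potential_def Let_def abcd[symmetric] left[folded abcd]
      by (cases b d rule: linorder_cases; simp add: defs; simp add: arc_def algebra_simps)
  next
    case right_lt
    from this[folded abcd] less show ?thesis
      unfolding inner_potential_def Let_def abcd[symmetric] right_lt[folded abcd]
      by (simp add: defs; simp add: arc_def algebra_simps)
  next
    case right_eq
    from this[folded abcd] less show ?thesis
      unfolding inner_potential_def Let_def abcd[symmetric] right_eq[folded abcd]
      by (simp add: defs; simp add: arc_def algebra_simps)
  next
    case right_gt
    from this[folded abcd] less show ?thesis
      unfolding inner_potential_def Let_def abcd[symmetric] right_gt[folded abcd]
      by (cases a d rule: linorder_cases; simp add: defs; simp add: arc_def algebra_simps)
  next
    case both_lt
    from this[folded abcd] less show ?thesis
      unfolding inner_potential_def Let_def abcd[symmetric] both_lt[folded abcd]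
      by (simp add: defs; simp add: arc_def algebra_simps)
  next
    case both_eq
    from this[folded abcd] less show ?thesis
      unfolding inner_potential_def Let_def abcd[symmetric] both_eq[folded abcd]
      by (simp add: defs; simp add: arc_def algebra_simps)
  next
    case both_gt
    from this[folded abcd] less show ?thesis
      unfolding inner_potential_def Let_def abcd[symmetric] both_gt[folded abcd]
      by (simp add: defs; simp add: arc_def algebra_simps)
  qed
qed

section \<open>Pattern containment and balancedness in terms of labels\<close>

text \<open>A word of length four has only itself as a subsequence of length four.\<close>

lemma contains_1324_z4:
  "contains_pattern (word f) [1, 3, 2, 4] \<longleftrightarrow> f X1 < f X3 \<and> f X3 < f X2 \<and> f X2 < f X4"
proof -
  have "contains_pattern (word f) [1, 3, 2, 4] \<longleftrightarrow> same_relative_order (word f) [1, 3, 2, 4]"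
  proof
    assume "contains_pattern (word f) [1, 3, 2, 4]"
    then obtain v where v: "subseq v (word f)" "same_relative_order v [1, 3, 2, 4]"
      by (auto simp: contains_pattern_def)
    then have "length v = length (word f)" by (simp add: same_relative_order_def word_def)
    with v show "same_relative_order (word f) [1, 3, 2, 4]" using subseq_same_length by blast
  qed (auto simp: contains_pattern_def)
  also have "\<dots> \<longleftrightarrow> f X1 < f X3 \<and> f X3 < f X2 \<and> f X2 < f X4"
    by (auto simp: same_relative_order_def word_def numeral_eq_Suc All_less_Suc2)
  finally show ?thesis .
qed

text \<open>Each shape determines the sorted word, and a product of integers vanishes iff a factor
  does. Outside these shapes \<open>defect\<close> is 0 by default and says nothing about
  balancedness.\<close>

lemma balanced_iff_defect:
  assumes "alternating f"
  shows "balanced q f \<longleftrightarrow> defect q (f X1) (f X2) (f X3) (f X4) = 0"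
proof -
  consider "f X1 < f X3" "f X3 < f X2" "f X2 < f X4" | "f X3 < f X1" "f X1 < f X4" "f X4 < f X2"
    using assms by (auto simp: alternating_def)
  then show ?thesis
  proof cases
    case 1
    then have "sort (word f) = [f X1, f X3, f X2, f X4]" by (simp add: word_def)
    with 1 show ?thesis by (auto simp: balanced_def defect_def)
  next
    case 2
    then have "sort (word f) = [f X3, f X1, f X4, f X2]" by (simp add: word_def)
    with 2 show ?thesis by (auto simp: balanced_def defect_def)
  qed
qed

theorem theorem7p8:
  fixes q :: nat and x :: z4 and \<O> :: "(z4 \<Rightarrow> nat) set"
  assumes "\<O> \<in> promotion_orbits q"
  shows "orbitmesic q (\<lambda>f. real (antipodal_sum kappa x f)) \<O> \<longleftrightarrow>
    orbit_avoids \<O> [1, 3, 2, 4] \<or> orbit_balanced q \<O>"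
proof -
  obtain f where f: "f \<in> Inc q" and \<O>: "\<O> = orbit (promotion q) f"
    using assms by (auto simp: promotion_orbits_def)
  have "q > 0" using f by (auto simp: Inc_z4)
  have Inc: "promotion q ` Inc q \<subseteq> (Inc q :: (z4 \<Rightarrow> nat) set)"
    using promotion_in_Inc by auto
  note S = finite_Inc inj_on_promotion Inc f
  define k where "k = defect q (f X1) (f X2) (f X3) (f X4)"
  have inv: "g \<in> Inc q \<and> defect q (g X1) (g X2) (g X3) (g X4) = k \<and>
      (alternating g \<longleftrightarrow> alternating f)" if "g \<in> \<O>" for g
    using that unfolding \<O>
    by induction
      (use f promotion_in_Inc defect_promotion alternating_promotion in \<open>auto simp: k_def\<close>)
  \<comment> \<open>\<open>orbit\<close> starts at the first iterate, so this is the immediate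
    witness that it is nonempty.\<close>
  have f': "promotion q f \<in> \<O>" unfolding \<O> by (rule orbit.base)

  let ?A = "\<lambda>f. real (antipodal_sum kappa x f)"
  have outer: "2 * int q * (int (g X1) + int (g X4) - (int q + 1)) =
      outer_potential q (promotion q g) - outer_potential q g + 2 * k"
    and inner: "2 * int q * (int (g X2) + int (g X3) - (int q + 1)) =
      inner_potential q (promotion q g) - inner_potential q g + - 2 * k"
    if "g \<in> orbit (promotion q) f" for g
    using inv[unfolded \<O>, OF that] outer_potential_promotion[of g q] inner_potential_promotion[of g q]
    by auto
  have "2 * int q \<noteq> 0" using \<open>q > 0\<close> by simp
  note avg = average_orbit_coboundary[OF S _ this]
  have "average (\<lambda>g. real_of_int (int (g X1) + int (g X4))) \<O>
      = real_of_int (int q + 1) + real_of_int (2 * k) / real_of_int (2 * int q)"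
    unfolding \<O> by (rule avg, erule outer)
  moreover have "average (\<lambda>g. real_of_int (int (g X2) + int (g X3))) \<O>
      = real_of_int (int q + 1) + real_of_int (- 2 * k) / real_of_int (2 * int q)"
    unfolding \<O> by (rule avg, erule inner)
  \<comment> \<open>The sign depends on whether \<open>x\<close> is an end of the fence, but either
    value equals \<open>q + 1\<close> only for \<open>k = 0\<close>.\<close>
  ultimately have "average ?A \<O> = q + 1 + k / q \<or> average ?A \<O> = q + 1 - k / q"
    by (cases x) (auto simp: antipodal_sum_def add.commute)
  moreover have "average ?A (Inc q) = q + 1"
    using f by (intro average_antipodal_sum_Inc kappa_involution kappa_order_reversing) auto
  ultimately have mesic: "orbitmesic q ?A \<O> \<longleftrightarrow> k = 0"
    using \<open>q > 0\<close> by (auto simp: orbitmesic_def)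

  show ?thesis
  proof (cases "alternating f")
    case False
    then have "k = 0" by (auto simp: k_def defect_def alternating_def)
    moreover have "orbit_avoids \<O> [1, 3, 2, 4]"
      using inv False unfolding orbit_avoids_def contains_1324_z4 alternating_def by blast
    ultimately show ?thesis using mesic by simp
  next
    case True
    \<comment> \<open>On an orbit with all words of shape 2413 every step would lower the label of \<open>X3\<close>.\<close>
    have "\<not> orbit_avoids \<O> [1, 3, 2, 4]"
    proof
      assume avoids: "orbit_avoids \<O> [1, 3, 2, 4]"
      have "int (promotion q g X3) = int (g X3) - 1" if g: "g \<in> \<O>" for g
      proof -
        have pg: "promotion q g \<in> \<O>" using g unfolding \<O> by (rule orbit.step)
        have "g \<in> Inc q" using inv g by blast
        have "h X3 < h X1 \<and> h X1 < h X4 \<and> h X4 < h X2" if "h \<in> \<O>" for h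
          using inv[OF that] avoids that True
          unfolding orbit_avoids_def contains_1324_z4 alternating_def by blast
        \<comment> \<open>If \<open>g X3 = 1\<close>, this step would turn 2413 into 1324, contrary
          to the shape of \<open>promotion q g\<close>.\<close>
        from this[OF g] this[OF pg] \<open>g \<in> Inc q\<close>[unfolded Inc_z4]
        show ?thesis unfolding promotion_z4[OF \<open>g \<in> Inc q\<close>] by (auto split: if_splits)
      qed
      \<comment> \<open>Promotion permutes the orbit, so the sum cannot drop, although each of its
        terms does.\<close>
      then have "(\<Sum>g\<in>\<O>. int (g X3) - 1) = (\<Sum>g\<in>\<O>. int (g X3))"
        using sum_orbit_comp[OF S, of "\<lambda>g. int (g X3)"] unfolding \<O> by simp
      moreover have "finite \<O>"
        using inv finite_Inc[of q, where 'a=z4] by (metis finite_subset subsetI)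
      ultimately show False using f' by (auto simp: sum_subtractf)
    qed
    moreover have "orbit_balanced q \<O> \<longleftrightarrow> k = 0"
      using inv True f' balanced_iff_defect unfolding orbit_balanced_def by metis
    ultimately show ?thesis using mesic by simp
  qed
qed

end
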